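(* Let $\lambda$ be a nonzero real number and let $Y$ be a random variable whose moment generating function $E[e^{Yt}]$ exists for $|t|<r$ for some $r>0$. For every integer $m\ge 1$, $$\mathrm{Bel}_{m,\lambda}^{(1,Y)}(x)=\sum_{n=1}^{m}(1)_{n,\lambda}{m \brace n}_{Y,\lambda}x^{n}.$$ In particular, $\mathrm{Bel}_{m,\lambda}^{(1,Y)}=\sum_{n=1}^{m}(1)_{n,\lambda}{m \brace n}_{Y,\lambda}$.
   Context: Degenerate falling factorial: $(x)_{0,\lambda}=1$, $(x)_{n,\lambda}=x(x-\lambda)(x-2\lambda)\cdots(x-(n-1)\lambda)$ for $n\ge1$. Degenerate exponential: $e_\lambda^x(t)=(1+\lambda t)^{x/\lambda}=\sum_{n\ge0}(x)_{n,\lambda}\frac{t^n}{n!}$, $e_\lambda(t)=e_\lambda^1(t)$. For $k\in\mathbb{Z}$, the degenerate polyexponential function is $\mathrm{Ei}_{k,\lambda}(x)=\sum_{n=1}^{\infty}\frac{(1)_{n,\lambda}}{(n-1)!\,n^{k}}x^{n}$. The probabilistic degenerate poly-Bell polynomials associated with $Y$ are defined by the power series identity in $t$ $$\mathrm{Ei}_{k,\lambda}\big(x(E[e_\lambda^Y(t)]-1)\big)=\sum_{n=1}^{\infty}\mathrm{Bel}_{n,\lambda}^{(k,Y)}(x)\frac{t^n}{n!},\qquad \mathrm{Bel}_{0,\lambda}^{(k,Y)}(x)=1,$$ and $\mathrm{Bel}_{n,\lambda}^{(k,Y)}=\mathrm{Bel}_{n,\lambda}^{(k,Y)}(1)$.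 The probabilistic degenerate Stirling numbers of the second kind associated with $Y$ are defined by $\frac{1}{k!}\big(E[e_\lambda^Y(t)]-1\big)^k=\sum_{n\ge k}{n \brace k}_{Y,\lambda}\frac{t^n}{n!}$ for $k\ge0$. *)

theory Defs
  imports "HOL-Probability.Probability"
begin

definition deg_ffact :: "real \<Rightarrow> real \<Rightarrow> nat \<Rightarrow> real" where
  "deg_ffact lam x n = (\<Prod>i<n. x - real i * lam)"

text \<open>The degenerate exponential, as a function of \<open>t\<close> with \<open>1 + lam * t > 0\<close>
  (the only range in which it is used, since all expansions below are taken at \<open>t = 0\<close>).\<close>

definition deg_exp :: "real \<Rightarrow> real \<Rightarrow> real \<Rightarrow> real" where
  "deg_exp lam x t = (1 + lam * t) powr (x / lam)"

lemma deg_exp_sums: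
  fixes lam x t :: real
  assumes "lam \<noteq> 0" and "\<bar>lam * t\<bar> < 1"
  shows "(\<lambda>n. deg_ffact lam x n * t ^ n / fact n) sums deg_exp lam x t"
proof -
  have *: "((x / lam) gchoose n) * (lam * t) ^ n = deg_ffact lam x n * t ^ n / fact n" for n
  proof -
    have "(\<Prod>i<n. x / lam - real i) * lam ^ n = (\<Prod>i<n. (x / lam - real i) * lam)"
      by (simp add: prod.distrib)
    also have "\<dots> = deg_ffact lam x n"
      unfolding deg_ffact_def using assms(1) by (intro prod.cong) (auto simp: field_simps)
    finally show ?thesis
      by (simp add: gbinomial_prod_rev atLeast0LessThan power_mult_distrib)
  qed
  show ?thesis
    using gen_binomial_real[OF assms(2), of "x / lam"] unfolding * deg_exp_def .
qed

definition deg_polyexp :: "int \<Rightarrow> real \<Rightarrow> real \<Rightarrow> real" where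
  "deg_polyexp k lam x =
     (\<Sum>n. if n = 0 then 0 else deg_ffact lam 1 n / (fact (n - 1) * real n powi k) * x ^ n)"

definition expect_deg_exp :: "'a measure \<Rightarrow> ('a \<Rightarrow> real) \<Rightarrow> real \<Rightarrow> real \<Rightarrow> real" where
  "expect_deg_exp M Y lam t = (LINT \<omega>|M. deg_exp lam (Y \<omega>) t)"

text \<open>The two families below are the coefficient sequences determined by their generating
  functions. The identities are between genuine functions of \<open>t\<close> near \<open>0\<close> and convergent power
  series, and such an expansion is unique.\<close>

text \<open>\<open>prob_deg_bell M Y k lam x n\<close> is the value at \<open>x\<close> of the \<open>n\<close>-th probabilistic degenerate
  poly-Bell polynomial of index \<open>k\<close>. The value \<open>1\<close> at \<open>n = 0\<close> is a convention: the series starts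
  at \<open>n = 1\<close>.\<close>

definition prob_deg_bell ::
  "'a measure \<Rightarrow> ('a \<Rightarrow> real) \<Rightarrow> int \<Rightarrow> real \<Rightarrow> real \<Rightarrow> nat \<Rightarrow> real" where
  "prob_deg_bell M Y k lam x =
     (THE B. B 0 = 1 \<and>
        (\<lambda>t. deg_polyexp k lam (x * (expect_deg_exp M Y lam t - 1)))
          has_fps_expansion Abs_fps (\<lambda>n. if n = 0 then 0 else B n / fact n))"

definition prob_deg_bell_number ::
  "'a measure \<Rightarrow> ('a \<Rightarrow> real) \<Rightarrow> int \<Rightarrow> real \<Rightarrow> nat \<Rightarrow> real" where
  "prob_deg_bell_number M Y k lam n = prob_deg_bell M Y k lam 1 n"

text \<open>\<open>prob_deg_Stirling M Y lam n k\<close> has \<open>n\<close> as upper and \<open>k\<close> as lower index; it is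
  \<open>0\<close> for \<open>n < k\<close>, where the series has no term.\<close>

definition prob_deg_Stirling ::
  "'a measure \<Rightarrow> ('a \<Rightarrow> real) \<Rightarrow> real \<Rightarrow> nat \<Rightarrow> nat \<Rightarrow> real" where
  "prob_deg_Stirling M Y lam n k =
     (THE S. (\<forall>j<k. S j = 0) \<and>
        (\<lambda>t. 1 / fact k * (expect_deg_exp M Y lam t - 1) ^ k)
          has_fps_expansion Abs_fps (\<lambda>j. S j / fact j)) n"

end

theory Submission
  imports Defs "HOL-Complex_Analysis.Complex_Analysis"
begin

text \<open>For small \<open>t\<close>, dominated convergence gives
  \<open>E[e\<^sub>\<lambda>\<^sup>Y(t)] = \<Sum>n. E[(Y)\<^sub>n\<^sub>,\<^sub>\<lambda>] t\<^sup>n / n!\<close>: replacing \<open>Y\<close>, \<open>\<lambda>\<close>, \<open>t\<close> by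
  \<open>\<bar>Y\<bar>\<close>, \<open>-\<bar>\<lambda>\<bar>\<close>, \<open>\<bar>t\<bar>\<close> yields a series of nonnegative terms that majorises the original one and
  sums to \<open>exp (s \<bar>Y\<bar>)\<close> for a small \<open>s\<close>. So all the generating functions are genuine power series,
  and since \<open>Ei\<close> of index \<open>1\<close> is \<open>\<Sum>n\<ge>1. (1)\<^sub>n\<^sub>,\<^sub>\<lambda> y\<^sup>n / n!\<close>, the theorem is the coefficient formula
  for its composition with \<open>x (E[e\<^sub>\<lambda>\<^sup>Y(t)] - 1)\<close>.\<close>

section \<open>Real power series expansions\<close>

text \<open>This makes both \<open>THE\<close> descriptions of coefficient sequences denote. The
  difference \<open>H\<close> vanishes on a whole neighbourhood of 0, whereas the zeros of a nonzero
  power series are isolated.\<close>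

lemma fps_expansion_unique:
  fixes F G :: "'a::{real_normed_field,banach} fps"
  assumes "f has_fps_expansion F" "f has_fps_expansion G"
  shows "F = G"
proof -
  define H where "H = F - G"
  have H: "(\<lambda>_. 0) has_fps_expansion H"
    using has_fps_expansion_diff[OF assms] by (simp add: H_def)
  then have "eventually (\<lambda>z. eval_fps H z = 0 \<and> z \<in> eball 0 (fps_conv_radius H)) (nhds 0)"
    by (intro eventually_conj eventually_nhds_in_open)
      (auto simp: has_fps_expansion_def zero_ereal_def)
  then obtain r where r: "r > 0"
    "\<And>z. dist z 0 < r \<Longrightarrow> eval_fps H z = 0 \<and> z \<in> eball 0 (fps_conv_radius H)"
    by (auto simp: eventually_nhds_metric)
  have sums: "(\<lambda>n. fps_nth H n * (z - 0) ^ n) sums 0" if "norm (z - 0) < r" for z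
    using sums_eval_fps[of z H] r(2)[of z] that by (auto simp: in_eball_iff)
  have "H = 0"
  proof (rule ccontr)
    assume "H \<noteq> 0"
    moreover have "fps_nth H 0 = 0"
      using r(2)[of 0] r(1) by (simp add: eval_fps_at_0)
    ultimately obtain m where m: "fps_nth H m \<noteq> 0" "m > 0"
      by (metis fps_nonzero_nth gr0I)
    \<comment> \<open>Isolation of zeros, applied to the constant function 0 that \<open>H\<close>
      represents; any point of the punctured ball then gives the contradiction.\<close>
    obtain s where s: "s > 0" "\<And>z::'a. z \<in> cball 0 s - {0} \<Longrightarrow> (0::'a) \<noteq> 0"
      using powser_0_nonzero[of r 0 "fps_nth H" "\<lambda>_. 0" m] r(1) sums m by blast
    show False
      using s(2)[of "of_real s"] s(1) by simp
  qed
  then show ?thesis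
    by (simp add: H_def)
qed

definition complexify_fps :: "real fps \<Rightarrow> complex fps" where
  "complexify_fps F = Abs_fps (\<lambda>n. complex_of_real (fps_nth F n))"

lemma fps_nth_complexify [simp]: "fps_nth (complexify_fps F) n = complex_of_real (fps_nth F n)"
  by (simp add: complexify_fps_def)

lemma fps_conv_radius_complexify [simp]: "fps_conv_radius (complexify_fps F) = fps_conv_radius F"
  by (simp add: fps_conv_radius_def conv_radius_def)

lemma eval_fps_complexify:
  assumes "ereal (norm x) < fps_conv_radius F"
  shows "eval_fps (complexify_fps F) (complex_of_real x) = complex_of_real (eval_fps F x)"
proof -
  have "(\<lambda>n. complex_of_real (fps_nth F n * x ^ n)) sums complex_of_real (eval_fps F x)"
    using sums_eval_fps[OF assms] by (simp only: sums_of_real_iff)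
  then show ?thesis
    by (simp add: eval_fps_def sums_iff)
qed

lemma complexify_fps_mult: "complexify_fps (F * G) = complexify_fps F * complexify_fps G"
  by (simp add: fps_eq_iff fps_mult_nth)

lemma complexify_fps_power: "complexify_fps (F ^ n) = complexify_fps F ^ n"
proof (induction n)
  case 0
  show ?case by (simp add: fps_eq_iff)
qed (simp add: complexify_fps_mult)

text \<open>A coefficient of a composition is a finite sum over powers of the inner series, so
  compatibility with powers is enough.\<close>

lemma complexify_fps_compose:
  "complexify_fps (F oo G) = complexify_fps F oo complexify_fps G"
  by (simp add: fps_eq_iff fps_compose_nth flip: complexify_fps_power)

text \<open>The complexified series reduce the claim to composition of complex expansions, restricted to the
  real axis.\<close>

lemma has_fps_expansion_compose_real:
  fixes f g :: "real \<Rightarrow> real"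
  assumes F: "f has_fps_expansion F" and G: "g has_fps_expansion G" and G0: "fps_nth G 0 = 0"
  shows "(\<lambda>x. f (g x)) has_fps_expansion (F oo G)"
proof -
  let ?F = "complexify_fps F" and ?G = "complexify_fps G"
  have rF: "fps_conv_radius F > 0" and rG: "fps_conv_radius G > 0"
    using F G by (auto simp: has_fps_expansion_def)
  have "(eval_fps ?F \<circ> eval_fps ?G) has_fps_expansion (?F oo ?G)"
    using rF rG G0 by (intro has_fps_expansion_compose eval_fps_has_fps_expansion) auto
  then have C: "(eval_fps ?F \<circ> eval_fps ?G) has_fps_expansion complexify_fps (F oo G)"
    by (simp add: complexify_fps_compose)
  then have rad: "fps_conv_radius (F oo G) > 0"
    by (auto simp: has_fps_expansion_def)
  have lim_real: "filterlim complex_of_real (nhds 0) (nhds 0)"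
    using tendsto_of_real[OF filterlim_ident[of "nhds (0::real)"]] by simp
  have near0: "eventually (\<lambda>x. x \<in> eball 0 (fps_conv_radius H)) (nhds 0)"
    if "fps_conv_radius H > 0" for H :: "real fps"
    using that by (intro eventually_nhds_in_open) (auto simp: zero_ereal_def)
  \<comment> \<open>As \<open>g\<close> tends to 0 at 0, every property of \<open>F\<close> valid
    near 0 holds at \<open>g x\<close> for small \<open>x\<close>.\<close>
  have "g 0 = 0"
    using has_fps_expansion_imp_0_eq_fps_nth_0[OF G] G0 by simp
  moreover have "isCont g 0"
    using has_fps_expansion_imp_continuous[OF G] .
  ultimately have lim_g: "filterlim g (nhds 0) (nhds 0)"
    by (simp add: continuous_at tendsto_nhds_iff)
  have ev_f: "eventually (\<lambda>x. eval_fps F (g x) = f (g x)) (nhds 0)"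
    using F lim_g by (auto simp: has_fps_expansion_def filterlim_iff)
  have ev_rF: "eventually (\<lambda>x. g x \<in> eball 0 (fps_conv_radius F)) (nhds 0)"
    using near0[OF rF] lim_g by (auto simp: filterlim_iff)
  have ev_g: "eventually (\<lambda>x. eval_fps G x = g x) (nhds 0)"
    using G by (auto simp: has_fps_expansion_def)
  have ev_C: "eventually (\<lambda>x. eval_fps (complexify_fps (F oo G)) (complex_of_real x) =
      eval_fps ?F (eval_fps ?G (complex_of_real x))) (nhds 0)"
    using C lim_real by (auto simp: has_fps_expansion_def filterlim_iff)
  \<comment> \<open>For small \<open>x\<close> all the points involved lie inside the discs of
    convergence, so the complex identity is the embedded real one, and
    \<open>complex_of_real\<close> is injective.\<close>
  have "eventually (\<lambda>x. eval_fps (F oo G) x = f (g x)) (nhds 0)"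
    using ev_f ev_rF ev_g ev_C near0[OF rG] near0[OF rad]
  proof eventually_elim
    case (elim x)
    then have "complex_of_real (eval_fps (F oo G) x) = complex_of_real (f (g x))"
      by (auto simp: in_eball_iff eval_fps_complexify)
    then show ?case by simp
  qed
  with rad show ?thesis
    by (simp add: has_fps_expansion_def)
qed

section \<open>The expected degenerate exponential\<close>

lemma eventually_abs_mult_less_1: "eventually (\<lambda>t::real. \<bar>c * t\<bar> < 1) (nhds 0)"
proof -
  have "isCont (\<lambda>t. \<bar>c * t\<bar>) 0"
    by (intro continuous_intros)
  then have "((\<lambda>t. \<bar>c * t\<bar>) \<longlongrightarrow> 0) (nhds 0)"
    by (simp add: continuous_at tendsto_nhds_iff)
  then show ?thesis
    by (rule order_tendstoD) simp
qed

text \<open>The triangle inequality, factor by factor. The parameter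
  \<open>- \<bar>lam\<bar>\<close> turns the factors into sums, and the bound is again a degenerate
  falling factorial, so its series has a closed form by \<open>deg_exp_sums\<close>.\<close>

lemma abs_deg_ffact_le: "\<bar>deg_ffact lam x n\<bar> \<le> deg_ffact (- \<bar>lam\<bar>) \<bar>x\<bar> n"
  unfolding deg_ffact_def abs_prod
proof (intro prod_mono conjI)
  fix i
  have "\<bar>x - real i * lam\<bar> \<le> \<bar>x\<bar> + \<bar>real i * lam\<bar>"
    by (rule abs_triangle_ineq4)
  then show "\<bar>x - real i * lam\<bar> \<le> \<bar>x\<bar> - real i * - \<bar>lam\<bar>"
    by (simp add: abs_mult)
qed auto

lemma deg_ffact_0 [simp]: "deg_ffact lam x 0 = 1"
  by (simp add: deg_ffact_def)

lemma measurable_deg_ffact [measurable]: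
  "Y \<in> borel_measurable M \<Longrightarrow> (\<lambda>\<omega>. deg_ffact lam (Y \<omega>) n) \<in> borel_measurable M"
  unfolding deg_ffact_def by (intro borel_measurable_prod borel_measurable_diff) auto

lemma measurable_deg_exp [measurable]:
  "Y \<in> borel_measurable M \<Longrightarrow> (\<lambda>\<omega>. deg_exp lam (Y \<omega>) t) \<in> borel_measurable M"
  unfolding deg_exp_def by measurable

text \<open>Dominated convergence for the partial sums: \<open>w\<close>, the sum of the nonnegative
  majorants \<open>b n\<close>, bounds every partial sum and also each single term, which makes the
  terms integrable.\<close>

lemma expect_deg_exp_sums:
  assumes [measurable]: "Y \<in> borel_measurable M"
    and lam: "lam \<noteq> 0" and t: "\<bar>lam * t\<bar> < 1"
    and int: "integrable M (\<lambda>\<omega>. deg_exp (- \<bar>lam\<bar>) \<bar>Y \<omega>\<bar> \<bar>t\<bar>)"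
  shows "(\<lambda>n. (LINT \<omega>|M. deg_ffact lam (Y \<omega>) n) / fact n * t ^ n) sums expect_deg_exp M Y lam t"
proof -
  define a where "a n \<omega> = deg_ffact lam (Y \<omega>) n * t ^ n / fact n" for n \<omega>
  define w where "w \<omega> = deg_exp (- \<bar>lam\<bar>) \<bar>Y \<omega>\<bar> \<bar>t\<bar>" for \<omega>
  define b where "b n \<omega> = deg_ffact (- \<bar>lam\<bar>) \<bar>Y \<omega>\<bar> n * \<bar>t\<bar> ^ n / fact n" for n \<omega>
  have [measurable]: "a n \<in> borel_measurable M" for n
    unfolding a_def by measurable
  have [measurable]: "w \<in> borel_measurable M"
    unfolding w_def by measurable
  have ab: "\<bar>a n \<omega>\<bar> \<le> b n \<omega>" for n \<omega>
    unfolding a_def b_def abs_divide abs_mult power_abs abs_of_nonneg[OF fact_ge_zero]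
    by (intro divide_right_mono mult_right_mono abs_deg_ffact_le) auto
  have b_sums: "(\<lambda>n. b n \<omega>) sums w \<omega>" for \<omega>
    unfolding b_def w_def using lam t by (intro deg_exp_sums) (auto simp: abs_mult)
  have b0: "b n \<omega> \<ge> 0" for n \<omega>
    using ab[of n \<omega>] by linarith
  have b_le: "sum (\<lambda>n. b n \<omega>) A \<le> w \<omega>" if "finite A" for A \<omega>
    using sum_le_suminf[of "\<lambda>n. b n \<omega>" A] b_sums[of \<omega>] b0 that by (auto simp: sums_iff)
  have aw: "norm (\<Sum>n<N. a n \<omega>) \<le> w \<omega>" for N \<omega>
    using sum_norm_le[of "{..<N}" "\<lambda>n. a n \<omega>" "\<lambda>n. b n \<omega>"] ab b_le[of "{..<N}" \<omega>] by force
  have int_w: "integrable M w"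
    using int by (simp add: w_def[abs_def])
  have int_a: "integrable M (a n)" for n
  proof (rule Bochner_Integration.integrable_bound[OF int_w])
    show "AE \<omega> in M. norm (a n \<omega>) \<le> norm (w \<omega>)"
    proof (rule AE_I2)
      fix \<omega>
      show "norm (a n \<omega>) \<le> norm (w \<omega>)"
        using ab[of n \<omega>] b_le[of "{n}" \<omega>] by simp
    qed
  qed simp
  have "(\<lambda>N. LINT \<omega>|M. (\<Sum>n<N. a n \<omega>)) \<longlonglongrightarrow> (LINT \<omega>|M. deg_exp lam (Y \<omega>) t)"
  proof (rule integral_dominated_convergence[where w = w])
    show "AE \<omega> in M. (\<lambda>N. \<Sum>n<N. a n \<omega>) \<longlonglongrightarrow> deg_exp lam (Y \<omega>) t"
      using deg_exp_sums[OF lam t] by (intro AE_I2) (simp add: a_def sums_def)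
  qed (use aw int_w in auto)
  then have "(\<lambda>n. LINT \<omega>|M. a n \<omega>) sums expect_deg_exp M Y lam t"
    using int_a by (simp add: sums_def expect_deg_exp_def)
  then show ?thesis
    by (simp add: a_def mult.commute)
qed

text \<open>Pointwise the integrand equals one of the two given exponentials, hence is at most their
  sum.\<close>

lemma integrable_exp_abs:
  fixes Y :: "'a \<Rightarrow> real"
  assumes [measurable]: "Y \<in> borel_measurable M"
    and "integrable M (\<lambda>\<omega>. exp (Y \<omega> * s))" "integrable M (\<lambda>\<omega>. exp (Y \<omega> * - s))"
  shows "integrable M (\<lambda>\<omega>. exp (\<bar>Y \<omega>\<bar> * s))"
proof (rule Bochner_Integration.integrable_bound)
  show "integrable M (\<lambda>\<omega>. exp (Y \<omega> * s) + exp (Y \<omega> * - s))"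
    using assms by (intro Bochner_Integration.integrable_add)
  show "AE \<omega> in M. norm (exp (\<bar>Y \<omega>\<bar> * s)) \<le> norm (exp (Y \<omega> * s) + exp (Y \<omega> * - s))"
    by (intro AE_I2) (auto simp: abs_if[of "Y _"] add_nonneg_nonneg)
qed simp

lemma expect_deg_exp_has_fps_expansion:
  assumes Y: "Y \<in> borel_measurable M"
    and mgf: "\<exists>r>0. \<forall>t. \<bar>t\<bar> < r \<longrightarrow> integrable M (\<lambda>\<omega>. exp (Y \<omega> * t))"
    and lam: "lam \<noteq> 0"
  shows "expect_deg_exp M Y lam
    has_fps_expansion Abs_fps (\<lambda>n. (LINT \<omega>|M. deg_ffact lam (Y \<omega>) n) / fact n)"
proof -
  obtain r where r: "r > 0" "\<And>t. \<bar>t\<bar> < r \<Longrightarrow> integrable M (\<lambda>\<omega>. exp (Y \<omega> * t))"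
    using mgf by blast
  \<comment> \<open>Chosen so that the majorant \<open>deg_exp (- \<bar>lam\<bar>) \<bar>Y
    \<omega>\<bar> \<bar>t\<bar>\<close> equals \<open>exp (\<bar>Y \<omega>\<bar> * s t)\<close>.
    Since \<open>s t\<close> tends to 0 with \<open>t\<close>, it falls into the range where the
    moment generating function exists.\<close>
  define s where "s t = ln (1 - \<bar>lam\<bar> * \<bar>t\<bar>) / - \<bar>lam\<bar>" for t :: real
  have "isCont (\<lambda>t. \<bar>s t\<bar>) 0"
    unfolding s_def using lam by (intro continuous_intros) auto
  then have "((\<lambda>t. \<bar>s t\<bar>) \<longlongrightarrow> 0) (nhds 0)"
    by (simp add: continuous_at tendsto_nhds_iff s_def)
  then have ev_s: "eventually (\<lambda>t. \<bar>s t\<bar> < r) (nhds 0)"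
    using r(1) by (auto dest: order_tendstoD)
  show ?thesis
  proof (rule has_fps_expansionI)
    show "eventually (\<lambda>t. (\<lambda>n. fps_nth (Abs_fps (\<lambda>n. (LINT \<omega>|M. deg_ffact lam (Y \<omega>) n) / fact n)) n
        * t ^ n) sums expect_deg_exp M Y lam t) (nhds 0)"
      using ev_s eventually_abs_mult_less_1[of lam]
    proof eventually_elim
      case (elim t)
      have "integrable M (\<lambda>\<omega>. exp (\<bar>Y \<omega>\<bar> * s t))"
        using elim(1) by (intro integrable_exp_abs Y r(2)) auto
      moreover have "exp (\<bar>Y \<omega>\<bar> * s t) = deg_exp (- \<bar>lam\<bar>) \<bar>Y \<omega>\<bar> \<bar>t\<bar>" for \<omega>
        using elim(2) by (auto simp: deg_exp_def powr_def s_def abs_mult)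
      ultimately show ?case
        using expect_deg_exp_sums[OF Y lam elim(2)] by simp
    qed
  qed
qed

section \<open>Coefficients of the generating functions\<close>

lemma prob_deg_Stirling_eq:
  assumes F: "expect_deg_exp M Y lam has_fps_expansion F" and F0: "fps_nth F 0 = 1"
  shows "prob_deg_Stirling M Y lam n k = fact n / fact k * fps_nth ((F - 1) ^ k) n"
proof -
  define S where "S j = fact j / fact k * fps_nth ((F - 1) ^ k) j" for j
  have S_fps: "Abs_fps (\<lambda>j. S j / fact j) = fps_const (1 / fact k) * (F - 1) ^ k"
    by (simp add: fps_eq_iff S_def)
  have exp: "(\<lambda>t. 1 / fact k * (expect_deg_exp M Y lam t - 1) ^ k) has_fps_expansion
      Abs_fps (\<lambda>j. S j / fact j)"
    unfolding S_fps by (intro fps_expansion_intros F)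
  have "(THE S. (\<forall>j<k. S j = 0) \<and> (\<lambda>t. 1 / fact k * (expect_deg_exp M Y lam t - 1) ^ k)
      has_fps_expansion Abs_fps (\<lambda>j. S j / fact j)) = S"
  proof (rule the_equality, intro conjI allI impI)
    \<comment> \<open>By \<open>F0\<close> the series \<open>F - 1\<close> has no constant term, so
      its \<open>k\<close>-th power starts at degree \<open>k\<close> or later.\<close>
    show "S j = 0" if "j < k" for j
      using startsby_zero_power_prefix[of "F - 1" k] F0 that by (simp add: S_def)
  next
    fix S'
    assume "(\<forall>j<k. S' j = 0) \<and> (\<lambda>t. 1 / fact k * (expect_deg_exp M Y lam t - 1) ^ k)
      has_fps_expansion Abs_fps (\<lambda>j. S' j / fact j)"
    then have "Abs_fps (\<lambda>j. S' j / fact j) = Abs_fps (\<lambda>j. S j / fact j)"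
      using fps_expansion_unique exp by blast
    then show "S' = S"
      by (simp add: fps_eq_iff fun_eq_iff)
  qed (rule exp)
  then show ?thesis
    by (simp add: prob_deg_Stirling_def S_def)
qed

text \<open>For \<open>n > 0\<close> the denominator \<open>fact (n - 1) * real n\<close> is
  \<open>fact n\<close>. Since \<open>deg_polyexp\<close> is an infinite sum by definition, only
  summability is left, and it comes from the binomial series of \<open>deg_exp lam 1 t\<close> with
  its initial 1 removed.\<close>

lemma deg_polyexp_1_has_fps_expansion:
  assumes lam: "lam \<noteq> 0"
  shows "deg_polyexp 1 lam
    has_fps_expansion Abs_fps (\<lambda>n. if n = 0 then 0 else deg_ffact lam 1 n / fact n)"
proof (rule has_fps_expansionI)
  show "eventually (\<lambda>t. (\<lambda>n. fps_nth
      (Abs_fps (\<lambda>n. if n = 0 then 0 else deg_ffact lam 1 n / fact n)) n * t ^ n)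
      sums deg_polyexp 1 lam t) (nhds 0)"
    using eventually_abs_mult_less_1[of lam]
  proof eventually_elim
    case (elim t)
    have eq: "(if n = 0 then 0 else deg_ffact lam 1 n / (fact (n - 1) * real n powi 1) * t ^ n) =
        (if n = 0 then 0 else deg_ffact lam 1 n / fact n) * t ^ n" for n
      by (cases n) (auto simp: mult.commute)
    have "(\<lambda>n. deg_ffact lam 1 n * t ^ n / fact n - (if n = 0 then 1 else 0)) sums
        (deg_exp lam 1 t - 1)"
      using sums_single[of 0 "\<lambda>_. 1 :: real"] by (intro sums_diff deg_exp_sums[OF lam elim]) auto
    moreover have "deg_ffact lam 1 n * t ^ n / fact n - (if n = 0 then 1 else 0) =
        (if n = 0 then 0 else deg_ffact lam 1 n / fact n) * t ^ n" for n
      by (cases n) auto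
    ultimately have "summable (\<lambda>n. (if n = 0 then 0 else deg_ffact lam 1 n / fact n) * t ^ n)"
      by (simp add: sums_iff)
    then show ?case
      unfolding deg_polyexp_def eq fps_nth_Abs_fps by (rule summable_sums)
  qed
qed

lemma prob_deg_bell_1_eq:
  assumes F: "expect_deg_exp M Y lam has_fps_expansion F" and F0: "fps_nth F 0 = 1"
    and lam: "lam \<noteq> 0" and m: "m \<ge> 1"
  shows "prob_deg_bell M Y 1 lam x m =
    (\<Sum>n=1..m. deg_ffact lam 1 n * prob_deg_Stirling M Y lam m n * x ^ n)"
proof -
  define P where "P = Abs_fps (\<lambda>n. if n = 0 then 0 else deg_ffact lam 1 n / fact n)"
  define C where "C = P oo (fps_const x * (F - 1))"
  \<comment> \<open>The value at 0 is the convention, not the constant coefficient of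
    \<open>C\<close>, which is 0. Uniqueness below therefore treats index 0 separately.\<close>
  define B where "B n = (if n = 0 then 1 else fact n * fps_nth C n)" for n
  have C0: "fps_nth C 0 = 0"
    by (simp add: C_def P_def)
  have B_fps: "Abs_fps (\<lambda>n. if n = 0 then 0 else B n / fact n) = C"
    using C0 by (simp add: fps_eq_iff B_def)
  have exp: "(\<lambda>t. deg_polyexp 1 lam (x * (expect_deg_exp M Y lam t - 1))) has_fps_expansion C"
    unfolding C_def P_def using F0
    by (intro has_fps_expansion_compose_real deg_polyexp_1_has_fps_expansion lam
        fps_expansion_intros F) simp
  have "prob_deg_bell M Y 1 lam x = B"
    unfolding prob_deg_bell_def
  proof (rule the_equality)
    show "B 0 = 1 \<and> (\<lambda>t. deg_polyexp 1 lam (x * (expect_deg_exp M Y lam t - 1)))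
      has_fps_expansion Abs_fps (\<lambda>n. if n = 0 then 0 else B n / fact n)"
      using exp by (simp add: B_fps) (simp add: B_def)
  next
    fix B'
    assume B': "B' 0 = 1 \<and> (\<lambda>t. deg_polyexp 1 lam (x * (expect_deg_exp M Y lam t - 1)))
      has_fps_expansion Abs_fps (\<lambda>n. if n = 0 then 0 else B' n / fact n)"
    then have eq: "Abs_fps (\<lambda>n. if n = 0 then 0 else B' n / fact n) = C"
      using fps_expansion_unique exp by blast
    show "B' = B"
    proof
      fix n
      show "B' n = B n"
        using B' arg_cong[OF eq, of "\<lambda>G. fps_nth G n"] by (cases "n = 0") (auto simp: B_def field_simps)
    qed
  qed
  then have "prob_deg_bell M Y 1 lam x m = fact m * fps_nth C m"
    using m by (simp add: B_def)
  also have "fps_nth C m = (\<Sum>n=0..m. fps_nth P n * (x ^ n * fps_nth ((F - 1) ^ n) m))"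
    by (simp add: C_def fps_compose_nth power_mult_distrib fps_const_power)
  \<comment> \<open>The term \<open>n = 0\<close> drops out because \<open>P\<close> has no constant
    term.\<close>
  also have "\<dots> = (\<Sum>n=1..m. fps_nth P n * (x ^ n * fps_nth ((F - 1) ^ n) m))"
    by (intro sum.mono_neutral_right) (auto simp: P_def not_less_eq_eq)
  \<comment> \<open>The \<open>fact n\<close> in the denominator of the coefficient of
    \<open>P\<close>, together with \<open>fact m\<close>, is the normalisation of the Stirling
    number.\<close>
  also have "fact m * \<dots> = (\<Sum>n=1..m. deg_ffact lam 1 n * prob_deg_Stirling M Y lam m n * x ^ n)"
    unfolding sum_distrib_left
    by (intro sum.cong) (auto simp: P_def prob_deg_Stirling_eq[OF F F0])
  finally show ?thesis .
qed

theorem theorem2p1: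
  fixes M :: "'a measure" and Y :: "'a \<Rightarrow> real" and lam :: real and m :: nat
  assumes "prob_space M"
    and "Y \<in> borel_measurable M"
    and "\<exists>r>0. \<forall>t. \<bar>t\<bar> < r \<longrightarrow> integrable M (\<lambda>\<omega>. exp (Y \<omega> * t))"
    and "lam \<noteq> 0"
    and "m \<ge> 1"
  shows "(\<forall>x::real. prob_deg_bell M Y 1 lam x m =
            (\<Sum>n=1..m. deg_ffact lam 1 n * prob_deg_Stirling M Y lam m n * x ^ n)) \<and>
         prob_deg_bell_number M Y 1 lam m =
            (\<Sum>n=1..m. deg_ffact lam 1 n * prob_deg_Stirling M Y lam m n)"
proof -
  \<comment> \<open>The constant coefficient is the expectation of the empty product, that is, the
    total mass of \<open>M\<close>.\<close>
  have "fps_nth (Abs_fps (\<lambda>n. (LINT \<omega>|M. deg_ffact lam (Y \<omega>) n) / fact n)) 0 = 1"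
    using prob_space.prob_space[OF assms(1)] by simp
  note bell = prob_deg_bell_1_eq[OF expect_deg_exp_has_fps_expansion[OF assms(2-4)] this assms(4,5)]
  show ?thesis
    unfolding prob_deg_bell_number_def bell by simp
qed

end
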